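(* Let $X$ be a real Banach space. Then the weak topology and the Lip-topology agree on $S_X$; that is, the topology on $S_X$ induced by the weak topology of $X$ coincides with the Lip-topology on $S_X$.
   Context: $S_X$ denotes the unit sphere of the real Banach space $X$. For a Lipschitz function $f:X\to\mathbb R$, let $\|f\|$ denote its (best) Lipschitz constant. A Lip-slice of $S_X$ is a non-empty set of the form $$S(S_X,f,\varepsilon):=\left\{\frac{x_1-x_2}{\|x_1-x_2\|}:\ x_1,x_2\in X,\ x_1\neq x_2,\ \frac{f(x_1)-f(x_2)}{\|x_1-x_2\|}>\|f\|-\varepsilon\right\},$$ where $f:X\to\mathbb R$ is Lipschitz and $\varepsilon>0$. The Lip-topology on $S_X$ is the topology on $S_X$ generated by taking the family of all Lip-slices of $S_X$ as a subbasis. *)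

theory Defs
  imports "HOL-Analysis.Analysis"
begin

text \<open>The continuous linear functionals on a real normed space are the functions
  \<open>f :: 'a \<Rightarrow> real\<close> with \<open>bounded_linear f\<close>; the weak topology is the coarsest one
  making all of them continuous.\<close>

definition weak_topology :: "'a::real_normed_vector topology" where
  "weak_topology =
     topology_generated_by {f -` U | (f :: 'a \<Rightarrow> real) U. bounded_linear f \<and> open U}"

definition is_Lipschitz :: "('a::real_normed_vector \<Rightarrow> real) \<Rightarrow> bool" where
  "is_Lipschitz f \<longleftrightarrow> (\<exists>L. L-lipschitz_on UNIV f)"

text \<open>The infimum is over a nonempty set of nonnegative reals, and is attained,
  whenever \<open>f\<close> is Lipschitz; otherwise the value is irrelevant.\<close>

definition Lip_const :: "('a::real_normed_vector \<Rightarrow> real) \<Rightarrow> real" where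
  "Lip_const f = Inf {L. L-lipschitz_on UNIV f}"

definition Lip_slice :: "('a::real_normed_vector \<Rightarrow> real) \<Rightarrow> real \<Rightarrow> 'a set" where
  "Lip_slice f \<epsilon> =
     {(x1 - x2) /\<^sub>R norm (x1 - x2) | x1 x2.
        x1 \<noteq> x2 \<and> (f x1 - f x2) / norm (x1 - x2) > Lip_const f - \<epsilon>}"

text \<open>The union of all Lip-slices is the whole unit sphere (take \<open>f = 0\<close>), so this is a
  topology with carrier \<open>sphere 0 1\<close>.\<close>

definition Lip_topology :: "'a::real_normed_vector topology" where
  "Lip_topology =
     topology_generated_by
       {Lip_slice f \<epsilon> | (f :: 'a \<Rightarrow> real) \<epsilon>. is_Lipschitz f \<and> \<epsilon> > 0 \<and> Lip_slice f \<epsilon> \<noteq> {}}"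

end

theory Submission
  imports Defs
begin

text \<open>Let \<open>p v\<close> be the supremum of all difference quotients \<open>(f (z + t v) - f z) / t\<close> with
  \<open>t > 0\<close>. This \<open>p\<close> is sublinear, and a Lip-slice of \<open>f\<close> is the part of the sphere where
  \<open>p\<close> exceeds a constant. By Hahn-Banach \<open>p\<close> is the pointwise maximum of the linear
  functionals below it, so a Lip-slice is a union of linear slices and thus weakly open in the
  sphere. Conversely, a linear slice is the Lip-slice of its functional.\<close>

section \<open>Sublinear functionals and the Hahn-Banach theorem\<close>

definition sublinear :: "('a::real_vector \<Rightarrow> real) \<Rightarrow> bool" where
  "sublinear p \<longleftrightarrow>
     (\<forall>x y. p (x + y) \<le> p x + p y) \<and> (\<forall>t x. t > 0 \<longrightarrow> p (t *\<^sub>R x) \<le> t * p x)"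

lemma sublinearI:
  assumes "\<And>x y. p (x + y) \<le> p x + p y" and "\<And>t x. t > 0 \<Longrightarrow> p (t *\<^sub>R x) \<le> t * p x"
  shows "sublinear p"
  using assms by (simp add: sublinear_def)

lemma sublinear_add: "sublinear p \<Longrightarrow> p (x + y) \<le> p x + p y"
  by (simp add: sublinear_def)

lemma sublinear_scaleR_le: "sublinear p \<Longrightarrow> t > 0 \<Longrightarrow> p (t *\<^sub>R x) \<le> t * p x"
  by (simp add: sublinear_def)

text \<open>The one-sided inequality, used with \<open>inverse t\<close> at the point
  \<open>t *\<^sub>R x\<close>, yields the reverse one. So homogeneity never has to be verified as
  an equation.\<close>

lemma sublinear_scaleR_pos:
  assumes "sublinear p" "t > 0"
  shows "p (t *\<^sub>R x) = t * p x"
proof (rule antisym)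
  have "p (inverse t *\<^sub>R (t *\<^sub>R x)) \<le> inverse t * p (t *\<^sub>R x)"
    using assms by (intro sublinear_scaleR_le) auto
  then show "t * p x \<le> p (t *\<^sub>R x)"
    using \<open>t > 0\<close> by (simp add: field_simps)
qed (use assms sublinear_scaleR_le in auto)

lemma sublinear_0:
  assumes "sublinear p"
  shows "p 0 = 0"
  \<comment> \<open>Scaling the zero vector by 2 gives \<open>p 0 = 2 * p 0\<close>.\<close>
  using sublinear_scaleR_pos[OF assms, of 2 0] by simp

lemma sublinear_scaleR:
  assumes "sublinear p" "t \<ge> 0"
  shows "p (t *\<^sub>R x) = t * p x"
  using assms by (cases "t = 0") (auto simp: sublinear_0 sublinear_scaleR_pos)

lemma sublinear_minus_ge:
  assumes "sublinear p"
  shows "- p (- x) \<le> p x"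
  using sublinear_add[OF assms, of x "- x"] sublinear_0[OF assms] by simp

text \<open>This supplies the bounds that Zorn's lemma asks for. Subadditivity is where the chain
  enters: the smaller \<open>s\<close> of two members \<open>p\<close> and \<open>r\<close>
  satisfies \<open>s (x + y) \<le> s x + s y \<le> p x + r y\<close>.\<close>

lemma sublinear_cINF_chain:
  assumes ne: "C \<noteq> {}" and sub: "\<And>p. p \<in> C \<Longrightarrow> sublinear p"
    and chain: "\<And>p r. p \<in> C \<Longrightarrow> r \<in> C \<Longrightarrow> p \<le> r \<or> r \<le> p"
    and bdd: "\<And>x. bdd_below ((\<lambda>p. p x) ` C)"
  shows "sublinear (\<lambda>x. INF p\<in>C. p x)"
proof (rule sublinearI)
  fix x y
  have "(INF p\<in>C. p (x + y)) - p x \<le> r y" if "p \<in> C" "r \<in> C" for p r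
  proof -
    have "p \<in> C" "r \<in> C" by (fact that)+
    obtain s where s: "s \<in> C" "s \<le> p" "s \<le> r"
    proof (cases "p \<le> r")
      case True
      then show thesis using that(1)[of p] \<open>p \<in> C\<close> by simp
    next
      case False
      then show thesis using that(1)[of r] \<open>r \<in> C\<close> chain[OF \<open>p \<in> C\<close> \<open>r \<in> C\<close>] by simp
    qed
    have "(INF p\<in>C. p (x + y)) \<le> s (x + y)"
      using bdd s(1) by (rule cINF_lower)
    also have "\<dots> \<le> s x + s y"
      using sub s(1) by (simp add: sublinear_add)
    also have "\<dots> \<le> p x + r y"
      using s by (intro add_mono) (auto simp: le_fun_def)
    finally show ?thesis by simp
  qed
  \<comment> \<open>The infimum is taken over \<open>r\<close> with \<open>p\<close> fixed, and
    afterwards over \<open>p\<close>.\<close>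
  then have "(INF p\<in>C. p (x + y)) - p x \<le> (INF p\<in>C. p y)" if "p \<in> C" for p
    using that ne by (intro cINF_greatest) auto
  then have "(INF p\<in>C. p (x + y)) - (INF p\<in>C. p y) \<le> (INF p\<in>C. p x)"
    using ne by (intro cINF_greatest) (auto simp: algebra_simps)
  then show "(INF p\<in>C. p (x + y)) \<le> (INF p\<in>C. p x) + (INF p\<in>C. p y)" by simp
next
  fix t :: real and x
  assume t: "t > 0"
  have "(INF p\<in>C. p (t *\<^sub>R x)) / t \<le> p x" if "p \<in> C" for p
    using cINF_lower[OF bdd that, of "t *\<^sub>R x"] sublinear_scaleR_pos[OF sub[OF that] t] t
    by (simp add: field_simps)
  then have "(INF p\<in>C. p (t *\<^sub>R x)) / t \<le> (INF p\<in>C. p x)"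
    using ne by (intro cINF_greatest) auto
  then show "(INF p\<in>C. p (t *\<^sub>R x)) \<le> t * (INF p\<in>C. p x)"
    using t by (simp add: field_simps)
qed

text \<open>Lowers \<open>p\<close> to a sublinear functional with value at most \<open>- p x\<close> at \<open>- x\<close>. Hence a minimal
  sublinear functional is odd and therefore linear, and one below \<open>reduce_along x p\<close> agrees
  with \<open>p\<close> at \<open>x\<close>.\<close>

definition reduce_along :: "'a \<Rightarrow> ('a::real_vector \<Rightarrow> real) \<Rightarrow> 'a \<Rightarrow> real" where
  "reduce_along x p v = (INF t\<in>{0..}. p (v + t *\<^sub>R x) - t * p x)"

context
  fixes p :: "'a::real_vector \<Rightarrow> real"
  assumes sub: "sublinear p"
begin

lemma reduce_along_le:
  assumes "t \<ge> 0"
  shows "reduce_along x p v \<le> p (v + t *\<^sub>R x) - t * p x"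
  unfolding reduce_along_def
proof (rule cINF_lower)
  \<comment> \<open>As \<open>t *\<^sub>R x\<close> is the sum of \<open>v + t *\<^sub>R x\<close>
    and \<open>- v\<close>, subadditivity gives a lower bound independent of \<open>t\<close>, so
    the infimum is finite.\<close>
  have "- p (- v) \<le> p (v + t *\<^sub>R x) - t * p x" if "t \<ge> 0" for t
    using sublinear_add[OF sub, of "v + t *\<^sub>R x" "- v"] sublinear_scaleR[OF sub that] by simp
  then show "bdd_below ((\<lambda>t. p (v + t *\<^sub>R x) - t * p x) ` {0..})"
    by (intro bdd_belowI2[where m = "- p (- v)"]) auto
qed (use assms in auto)

lemma reduce_along_greatest:
  assumes "\<And>t. t \<ge> 0 \<Longrightarrow> b \<le> p (v + t *\<^sub>R x) - t * p x"
  shows "b \<le> reduce_along x p v"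
  unfolding reduce_along_def using assms by (intro cINF_greatest) auto

lemma reduce_along_below: "reduce_along x p \<le> p"
  using reduce_along_le[of 0] by (simp add: le_fun_def)

lemma reduce_along_minus: "reduce_along x p (- x) \<le> - p x"
  \<comment> \<open>At \<open>t = 1\<close> the vector \<open>- x + t *\<^sub>R x\<close>
    vanishes.\<close>
  using reduce_along_le[of 1 x "- x"] sublinear_0[OF sub] by simp

text \<open>The parameters add up: \<open>t\<close> for \<open>v\<close> and \<open>s\<close> for
  \<open>w\<close> give \<open>t + s\<close> for \<open>v + w\<close>. Likewise \<open>t\<close> for
  \<open>v\<close> corresponds to \<open>c * t\<close> for \<open>c *\<^sub>R v\<close>.\<close>

lemma sublinear_reduce_along: "sublinear (reduce_along x p)"
proof (rule sublinearI)
  fix v w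
  have "reduce_along x p (v + w) - (p (v + t *\<^sub>R x) - t * p x) \<le> p (w + s *\<^sub>R x) - s * p x"
    if "t \<ge> 0" "s \<ge> 0" for s t
    using reduce_along_le[of "t + s" x "v + w"] that
      sublinear_add[OF sub, of "v + t *\<^sub>R x" "w + s *\<^sub>R x"]
    by (simp add: algebra_simps)
  then have "reduce_along x p (v + w) - (p (v + t *\<^sub>R x) - t * p x) \<le> reduce_along x p w"
    if "t \<ge> 0" for t
    using that by (intro reduce_along_greatest) auto
  then have "reduce_along x p (v + w) - reduce_along x p w \<le> reduce_along x p v"
    by (intro reduce_along_greatest) (simp add: algebra_simps)
  then show "reduce_along x p (v + w) \<le> reduce_along x p v + reduce_along x p w" by simp
next
  fix c :: real and v
  assume c: "c > 0"
  have "reduce_along x p (c *\<^sub>R v) / c \<le> p (v + t *\<^sub>R x) - t * p x" if "t \<ge> 0" for t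
    using reduce_along_le[of "c * t" x "c *\<^sub>R v"] c that
      sublinear_scaleR_pos[OF sub c, of "v + t *\<^sub>R x"]
    by (simp add: field_simps scaleR_add_right)
  then have "reduce_along x p (c *\<^sub>R v) / c \<le> reduce_along x p v"
    by (rule reduce_along_greatest)
  then show "reduce_along x p (c *\<^sub>R v) \<le> c * reduce_along x p v"
    using c by (simp add: field_simps)
qed

lemma minimal_sublinear_exists:
  obtains m where "sublinear m" "m \<le> p" "\<And>r. sublinear r \<Longrightarrow> r \<le> m \<Longrightarrow> r = m"
proof -
  let ?A = "{r. sublinear r \<and> r \<le> p}"
  \<comment> \<open>The order is reversed, so that Zorn's lemma yields a minimal functional.\<close>
  let ?P = "\<lambda>r s :: 'a \<Rightarrow> real. s \<le> r"
  have "\<exists>m\<in>?A. \<forall>r\<in>?A. ?P m r \<longrightarrow> r = m"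
  proof (rule predicate_Zorn)
    show "partial_order_on ?A (relation_of ?P ?A)"
      by (rule partial_order_on_relation_ofI) auto
  next
    fix C assume C: "C \<in> Chains (relation_of ?P ?A)"
    have CA: "sublinear r" "r \<le> p" if "r \<in> C" for r
      using C that by (auto simp: Chains_def relation_of_def)
    have chain: "r \<le> s \<or> s \<le> r" if "r \<in> C" "s \<in> C" for r s
      using C that by (auto simp: Chains_def relation_of_def)
    show "\<exists>u\<in>?A. \<forall>r\<in>C. ?P r u"
    proof (cases "C = {}")
      case True
      then show ?thesis using sub by auto
    next
      case False
      then obtain r where r: "r \<in> C" by auto
      \<comment> \<open>All members of the chain share this bound, because
        \<open>s x \<ge> - s (- x)\<close> and \<open>s \<le> p\<close>.\<close>
      have "- p (- x) \<le> s x" if "s \<in> C" for s x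
        using sublinear_minus_ge[OF CA(1)[OF that], of x] le_funD[OF CA(2)[OF that], of "- x"]
        by simp
      then have bdd: "bdd_below ((\<lambda>s. s x) ` C)" for x
        by (intro bdd_belowI2[where m = "- p (- x)"])
      let ?u = "\<lambda>x. INF s\<in>C. s x"
      have u: "?u \<le> s" if "s \<in> C" for s
        using bdd that by (auto simp: le_fun_def intro: cINF_lower)
      moreover have "sublinear ?u"
        using False CA(1) chain bdd by (rule sublinear_cINF_chain)
      moreover have "?u \<le> p" using u[OF r] CA(2)[OF r] by (rule order_trans)
      ultimately show ?thesis by (intro bexI[of _ ?u]) auto
    qed
  qed
  then obtain m where m: "sublinear m" "m \<le> p"
    and min: "\<And>r. sublinear r \<Longrightarrow> r \<le> p \<Longrightarrow> r \<le> m \<Longrightarrow> r = m" by auto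
  show thesis
    \<comment> \<open>Anything below \<open>m\<close> is below \<open>p\<close>, so minimality
      within \<open>?A\<close> is minimality among all sublinear functionals.\<close>
    by (rule that[OF m]) (use min m(2) order_trans in blast)
qed

end

text \<open>Oddness turns subadditivity at \<open>- x\<close> and \<open>- y\<close> into
  superadditivity at \<open>x\<close> and \<open>y\<close>, and carries homogeneity over to negative
  scalars.\<close>

lemma sublinear_odd_imp_linear:
  assumes sub: "sublinear p" and odd: "\<And>x. p (- x) = - p x"
  shows "linear p"
proof (rule linearI)
  fix x y
  show "p (x + y) = p x + p y"
    using sublinear_add[OF sub, of x y] sublinear_add[OF sub, of "- x" "- y"] odd[of "x + y"]
    by (simp add: odd)
next
  fix c x
  show "p (c *\<^sub>R x) = c *\<^sub>R p x"
  proof (cases "c \<ge> 0")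
    case True
    then show ?thesis using sub by (simp add: sublinear_scaleR)
  next
    case False
    then have "p (- (c *\<^sub>R x)) = - c * p x"
      using sublinear_scaleR[OF sub, of "- c" x] by simp
    then show ?thesis by (simp add: odd)
  qed
qed

lemma Hahn_Banach_supporting:
  assumes sub: "sublinear p"
  obtains g where "linear g" "\<And>v. g v \<le> p v" "g x = p x"
proof -
  \<comment> \<open>A minimal functional below \<open>p\<close> need not touch \<open>p\<close> at
    \<open>x\<close>. Starting from \<open>reduce_along x p\<close> forces
    \<open>m (- x) \<le> - p x\<close>, hence \<open>p x \<le> m x\<close> once \<open>m\<close> is
    odd.\<close>
  obtain m where m: "sublinear m" "m \<le> reduce_along x p"
    and min: "\<And>r. sublinear r \<Longrightarrow> r \<le> m \<Longrightarrow> r = m"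
    using minimal_sublinear_exists[OF sublinear_reduce_along[OF sub]] by blast
  have odd: "m (- v) = - m v" for v
  proof (rule antisym)
    \<comment> \<open>Reducing \<open>m\<close> along any \<open>v\<close> stays sublinear and below
      \<open>m\<close>, so minimality leaves \<open>m\<close> unchanged.\<close>
    have "reduce_along v m = m"
      by (intro min sublinear_reduce_along reduce_along_below m(1))
    then show "m (- v) \<le> - m v" using reduce_along_minus[OF m(1), of v] by simp
    show "- m v \<le> m (- v)" using sublinear_minus_ge[OF m(1), of "- v"] by simp
  qed
  have le: "m v \<le> p v" for v
    using m(2) reduce_along_below[OF sub, of x] by (meson le_funD order_trans)
  have "m (- x) \<le> - p x"
    using m(2) reduce_along_minus[OF sub, of x] by (meson le_funD order_trans)
  then have "m x = p x" using le[of x] odd[of x] by simp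
  then show thesis
    using that[of m] le sublinear_odd_imp_linear[OF m(1) odd] by blast
qed

section \<open>Difference quotients of a Lipschitz function\<close>

definition max_quotient :: "('a::real_normed_vector \<Rightarrow> real) \<Rightarrow> 'a \<Rightarrow> real" where
  "max_quotient f v = (SUP (z, t)\<in>UNIV \<times> {0<..}. (f (z + t *\<^sub>R v) - f z) / t)"

context
  fixes f :: "'a::real_normed_vector \<Rightarrow> real" and L :: real
  assumes lip: "L-lipschitz_on UNIV f"
begin

lemma quotient_le_lipschitz:
  assumes "t > 0"
  shows "(f (z + t *\<^sub>R v) - f z) / t \<le> L * norm v"
  using lipschitz_onD[OF lip, of "z + t *\<^sub>R v" z] assms
  by (simp add: dist_norm field_simps abs_le_iff)

lemma bdd_above_quotients:
  "bdd_above ((\<lambda>(z, t). (f (z + t *\<^sub>R v) - f z) / t) ` (UNIV \<times> {0<..}))"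
  by (rule bdd_aboveI2[where M = "L * norm v"]) (auto simp: quotient_le_lipschitz)

lemma quotient_le_max_quotient: "t > 0 \<Longrightarrow> (f (z + t *\<^sub>R v) - f z) / t \<le> max_quotient f v"
  unfolding max_quotient_def
  using cSUP_upper[OF _ bdd_above_quotients, of "(z, t)" v] by simp

lemma max_quotient_least:
  assumes "\<And>z t. t > 0 \<Longrightarrow> (f (z + t *\<^sub>R v) - f z) / t \<le> b"
  shows "max_quotient f v \<le> b"
  unfolding max_quotient_def
proof (rule cSUP_least)
  have "(0, 1) \<in> (UNIV :: 'a set) \<times> {0 :: real<..}" by simp
  then show "(UNIV :: 'a set) \<times> {0 :: real<..} \<noteq> {}" by blast
qed (use assms in auto)

lemma less_max_quotient_iff:
  "c < max_quotient f v \<longleftrightarrow> (\<exists>z t. t > 0 \<and> c < (f (z + t *\<^sub>R v) - f z) / t)"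
proof
  assume "c < max_quotient f v"
  then show "\<exists>z t. t > 0 \<and> c < (f (z + t *\<^sub>R v) - f z) / t"
    using max_quotient_least[of v c] by (force simp: not_less)
next
  assume "\<exists>z t. t > 0 \<and> c < (f (z + t *\<^sub>R v) - f z) / t"
  then obtain z t where "t > 0" "c < (f (z + t *\<^sub>R v) - f z) / t" by blast
  then show "c < max_quotient f v"
    using quotient_le_max_quotient[of t z v] by linarith
qed

text \<open>The step from \<open>z\<close> in direction \<open>v + w\<close> is split at
  \<open>z + t *\<^sub>R w\<close>; here it matters that the supremum runs over all base points. A
  step \<open>t\<close> along \<open>c *\<^sub>R v\<close> is a step \<open>t * c\<close> along
  \<open>v\<close>.\<close>

lemma sublinear_max_quotient: "sublinear (max_quotient f)"
proof (rule sublinearI)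
  fix v w
  show "max_quotient f (v + w) \<le> max_quotient f v + max_quotient f w"
  proof (rule max_quotient_least)
    fix z and t :: real
    assume t: "t > 0"
    have "(f (z + t *\<^sub>R (v + w)) - f z) / t
        = (f ((z + t *\<^sub>R w) + t *\<^sub>R v) - f (z + t *\<^sub>R w)) / t + (f (z + t *\<^sub>R w) - f z) / t"
      by (simp add: algebra_simps add_divide_distrib diff_divide_distrib)
    also have "\<dots> \<le> max_quotient f v + max_quotient f w"
      by (intro add_mono quotient_le_max_quotient t)
    finally show "(f (z + t *\<^sub>R (v + w)) - f z) / t \<le> max_quotient f v + max_quotient f w" .
  qed
next
  fix c :: real and v
  assume c: "c > 0"
  show "max_quotient f (c *\<^sub>R v) \<le> c * max_quotient f v"
  proof (rule max_quotient_least)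
    fix z and t :: real
    assume t: "t > 0"
    show "(f (z + t *\<^sub>R c *\<^sub>R v) - f z) / t \<le> c * max_quotient f v"
      using quotient_le_max_quotient[of "t * c" z v] c t by (simp add: field_simps)
  qed
qed

text \<open>Two distinct points amount to a base point, a unit direction and a step equal to their
  distance. Since the inequality is strict, the supremum exceeds the threshold exactly when a single
  quotient does.\<close>

lemma Lip_slice_eq_max_quotient:
  "Lip_slice f \<epsilon> = {y \<in> sphere 0 1. Lip_const f - \<epsilon> < max_quotient f y}"
proof (intro set_eqI iffI)
  fix y
  assume "y \<in> Lip_slice f \<epsilon>"
  then obtain a b where ab: "a \<noteq> b" "y = (a - b) /\<^sub>R norm (a - b)"
    "Lip_const f - \<epsilon> < (f a - f b) / norm (a - b)"
    unfolding Lip_slice_def by blast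
  then have "a = b + norm (a - b) *\<^sub>R y" by simp
  then have "(f a - f b) / norm (a - b) \<le> max_quotient f y"
    using quotient_le_max_quotient[of "norm (a - b)" b y] ab(1) by simp
  moreover have "norm y = 1" using ab(1,2) by simp
  ultimately show "y \<in> {y \<in> sphere 0 1. Lip_const f - \<epsilon> < max_quotient f y}"
    using ab(3) by simp
next
  fix y
  assume "y \<in> {y \<in> sphere 0 1. Lip_const f - \<epsilon> < max_quotient f y}"
  then obtain z t where zt: "norm y = 1" "t > 0" "Lip_const f - \<epsilon> < (f (z + t *\<^sub>R y) - f z) / t"
    by (auto simp: less_max_quotient_iff)
  moreover have "y \<noteq> 0" using zt(1) by auto
  ultimately show "y \<in> Lip_slice f \<epsilon>"
    unfolding Lip_slice_def by (intro CollectI exI[of _ "z + t *\<^sub>R y"] exI[of _ z]) simp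
qed

end

lemma Lip_slice_subset_sphere: "Lip_slice f \<epsilon> \<subseteq> sphere 0 1"
  by (auto simp: Lip_slice_def)

section \<open>Lip-slices of linear functionals\<close>

lemma bounded_linear_imp_is_Lipschitz: "bounded_linear f \<Longrightarrow> is_Lipschitz f"
  unfolding is_Lipschitz_def using bounded_linear.lipschitz_boundE by blast

text \<open>Every Lipschitz constant bounds \<open>f y - f 0\<close>, because \<open>y\<close> has
  distance 1 from 0. Hence the half-space \<open>a < f y\<close> misses the sphere when
  \<open>a \<ge> Lip_const f\<close>.\<close>

lemma bounded_linear_le_Lip_const:
  assumes f: "bounded_linear f" and y: "norm y = 1"
  shows "f y \<le> Lip_const f"
  unfolding Lip_const_def
proof (rule cInf_greatest)
  show "{L. L-lipschitz_on UNIV f} \<noteq> {}"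
    using bounded_linear_imp_is_Lipschitz[OF f] by (auto simp: is_Lipschitz_def)
next
  fix L assume "L \<in> {L. L-lipschitz_on UNIV f}"
  then have "L-lipschitz_on UNIV f" by simp
  from lipschitz_onD[OF this, of y 0] show "f y \<le> L"
    using y by (simp add: linear_0[OF bounded_linear.linear[OF f]] dist_norm)
qed

text \<open>A difference quotient of a linear functional is its value at the unit direction;
  conversely, the pair \<open>y\<close>, \<open>0\<close> realises the direction
  \<open>y\<close>.\<close>

lemma Lip_slice_bounded_linear:
  assumes f: "bounded_linear f"
  shows "Lip_slice f \<epsilon> = {y \<in> sphere 0 1. Lip_const f - \<epsilon> < f y}"
proof (intro set_eqI iffI)
  fix y assume "y \<in> Lip_slice f \<epsilon>"
  then obtain a b where "a \<noteq> b" "y = (a - b) /\<^sub>R norm (a - b)"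
    "Lip_const f - \<epsilon> < (f a - f b) / norm (a - b)"
    unfolding Lip_slice_def by blast
  then show "y \<in> {y \<in> sphere 0 1. Lip_const f - \<epsilon> < f y}"
    by (simp add: linear_scale[OF bounded_linear.linear[OF f]]
        linear_diff[OF bounded_linear.linear[OF f]] divide_inverse mult.commute)
next
  fix y assume y: "y \<in> {y \<in> sphere 0 1. Lip_const f - \<epsilon> < f y}"
  moreover from y have "y \<noteq> 0" by auto
  ultimately show "y \<in> Lip_slice f \<epsilon>"
    unfolding Lip_slice_def
    by (intro CollectI exI[of _ y] exI[of _ 0]) (simp add: linear_0[OF bounded_linear.linear[OF f]])
qed

section \<open>Comparison of the two topologies\<close>

lemma topspace_weak_topology: "topspace (weak_topology :: 'a::real_normed_vector topology) = UNIV"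
proof -
  have "(\<lambda>_::'a. 0::real) -` UNIV \<in> {f -` U | (f :: 'a \<Rightarrow> real) U. bounded_linear f \<and> open U}"
    by (intro CollectI exI conjI) (auto intro: bounded_linear_zero)
  then show ?thesis
    unfolding weak_topology_def topology_generated_by_topspace by blast
qed

lemma openin_Lip_topology_Lip_slice:
  assumes "is_Lipschitz f" "\<epsilon> > 0"
  shows "openin Lip_topology (Lip_slice f \<epsilon>)"
proof (cases "Lip_slice f \<epsilon> = {}")
  case False
  then show ?thesis
    unfolding Lip_topology_def using assms by (intro topology_generated_by_Basis) auto
qed simp

lemma openin_Lip_topology_halfspace:
  fixes f :: "'a::real_normed_vector \<Rightarrow> real"
  assumes f: "bounded_linear f"
  shows "openin Lip_topology {y \<in> sphere 0 1. a < f y}"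
proof (cases "a < Lip_const f")
  case True
  \<comment> \<open>This choice of the slice width puts the threshold at \<open>a\<close>, and it is
    positive by the case assumption.\<close>
  then have "openin Lip_topology (Lip_slice f (Lip_const f - a))"
    using bounded_linear_imp_is_Lipschitz[OF f] by (intro openin_Lip_topology_Lip_slice) auto
  then show ?thesis by (simp add: Lip_slice_bounded_linear[OF f])
next
  case False
  then have "{y \<in> sphere 0 1. a < f y} = {}"
    using bounded_linear_le_Lip_const[OF f] by fastforce
  then show ?thesis by (simp only: openin_empty)
qed

lemma topspace_Lip_topology:
  "topspace (Lip_topology :: 'a::real_normed_vector topology) = sphere 0 1"
proof
  show "topspace (Lip_topology :: 'a topology) \<subseteq> sphere 0 1"
    unfolding Lip_topology_def topology_generated_by_topspace
    using Lip_slice_subset_sphere by blast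
  show "sphere 0 1 \<subseteq> topspace (Lip_topology :: 'a topology)"
    \<comment> \<open>For the zero functional and level \<open>- 1\<close> the half-space contains
      the whole sphere.\<close>
    using openin_Lip_topology_halfspace[OF bounded_linear_zero, of "- 1", THEN openin_subset]
    by (simp add: sphere_def)
qed

lemma continuous_map_Lip_topology_bounded_linear:
  assumes f: "bounded_linear f"
  shows "continuous_map Lip_topology euclideanreal f"
  unfolding continuous_map_upper_lower_semicontinuous_lt topspace_Lip_topology
proof (intro conjI allI)
  fix a
  show "openin Lip_topology {x \<in> sphere 0 1. a < f x}"
    using f by (rule openin_Lip_topology_halfspace)
  show "openin Lip_topology {x \<in> sphere 0 1. f x < a}"
    using openin_Lip_topology_halfspace[OF bounded_linear_minus[OF f], of "- a"] by simp
qed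

lemma openin_weak_topology_halfspace:
  fixes f :: "'a::real_normed_vector \<Rightarrow> real"
  assumes f: "bounded_linear f"
  shows "openin weak_topology {y. a < f y}"
proof -
  have "f -` {a<..} \<in> {f -` U | (f :: 'a \<Rightarrow> real) U. bounded_linear f \<and> open U}"
    using f open_greaterThan by blast
  then have "openin weak_topology (f -` {a<..})"
    unfolding weak_topology_def by (rule topology_generated_by_Basis)
  also have "f -` {a<..} = {y. a < f y}" by auto
  finally show ?thesis .
qed

lemma openin_weak_topology_Lip_slice:
  assumes "is_Lipschitz f"
  shows "openin (subtopology weak_topology (sphere 0 1)) (Lip_slice f \<epsilon>)"
proof -
  obtain L where lip: "L-lipschitz_on UNIV f"
    using assms by (auto simp: is_Lipschitz_def)
  let ?c = "Lip_const f - \<epsilon>"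
  have "\<exists>T. openin (subtopology weak_topology (sphere 0 1)) T \<and> x \<in> T \<and> T \<subseteq> Lip_slice f \<epsilon>"
    if x: "x \<in> Lip_slice f \<epsilon>" for x
  proof -
    \<comment> \<open>The functional is chosen to support \<open>max_quotient f\<close> at the given
      point \<open>x\<close>, so the linear slice built from it contains \<open>x\<close> and stays
      inside the Lip-slice.\<close>
    obtain g where g: "linear g" "\<And>v. g v \<le> max_quotient f v" "g x = max_quotient f x"
      using Hahn_Banach_supporting[OF sublinear_max_quotient[OF lip]] by blast
    \<comment> \<open>Continuity of \<open>g\<close> comes from the Lipschitz bound on
      \<open>max_quotient f\<close>, used at both \<open>v\<close> and \<open>- v\<close>.\<close>
    have "g v \<le> L * norm v" for v
      using g(2)[of v] max_quotient_least[OF lip, of v, OF quotient_le_lipschitz[OF lip]]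
      by simp
    from this this[of "- v" for v] have "norm (g v) \<le> L * norm v" for v
      by (simp add: linear_neg[OF g(1)] abs_le_iff)
    then have "bounded_linear g"
      using g(1) by (auto simp: bounded_linear_def bounded_linear_axioms_def mult.commute)
    then have "openin (subtopology weak_topology (sphere 0 1)) (sphere 0 1 \<inter> {y. ?c < g y})"
      by (intro openin_subtopology_Int2 openin_weak_topology_halfspace)
    moreover have "sphere 0 1 \<inter> {y. ?c < g y} \<subseteq> Lip_slice f \<epsilon>"
      using g(2) by (auto simp: Lip_slice_eq_max_quotient[OF lip] intro: less_le_trans)
    moreover have "x \<in> sphere 0 1 \<inter> {y. ?c < g y}"
      using x g(3) by (simp add: Lip_slice_eq_max_quotient[OF lip])
    ultimately show ?thesis by blast
  qed
  then show ?thesis by (subst openin_subopen) blast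
qed

theorem theorem2p4:
  shows "subtopology weak_topology (sphere (0 :: 'a::banach) 1) = Lip_topology"
proof -
  let ?W = "subtopology weak_topology (sphere (0 :: 'a) 1)"
  let ?T = "Lip_topology :: 'a topology"
  let ?B = "{f -` U | (f :: 'a \<Rightarrow> real) U. bounded_linear f \<and> open U}"
  let ?S = "{Lip_slice f \<epsilon> | (f :: 'a \<Rightarrow> real) \<epsilon>. is_Lipschitz f \<and> \<epsilon> > 0 \<and> Lip_slice f \<epsilon> \<noteq> {}}"
  \<comment> \<open>The generators must cover the image of the identity before its continuity can be
    tested on generators alone.\<close>
  have unionB: "\<Union> ?B = UNIV"
    using topspace_weak_topology[where 'a = 'a]
    unfolding weak_topology_def topology_generated_by_topspace .
  have unionS: "\<Union> ?S = sphere 0 1"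
    using topspace_Lip_topology[where 'a = 'a]
    unfolding Lip_topology_def topology_generated_by_topspace .
  have "continuous_map ?T (topology_generated_by ?B) id"
  proof (rule continuous_on_generated_topo)
    fix V assume "V \<in> ?B"
    then obtain f :: "'a \<Rightarrow> real" and U where V: "V = f -` U" "bounded_linear f" "open U"
      by blast
    then have "openin ?T {y \<in> topspace ?T. f y \<in> U}"
      by (intro openin_continuous_map_preimage[OF continuous_map_Lip_topology_bounded_linear]) auto
    also have "{y \<in> topspace ?T. f y \<in> U} = id -` V \<inter> topspace ?T"
      using V(1) by auto
    finally show "openin ?T (id -` V \<inter> topspace ?T)" .
  qed (simp only: unionB subset_UNIV)
  then have TW: "continuous_map ?T ?W id"
    unfolding weak_topology_def[symmetric]
    by (simp add: continuous_map_in_subtopology topspace_Lip_topology)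
  have WT: "continuous_map ?W (topology_generated_by ?S) id"
  proof (rule continuous_on_generated_topo)
    fix V assume "V \<in> ?S"
    then have "openin ?W V"
      using openin_weak_topology_Lip_slice by blast
    moreover from this have "id -` V \<inter> topspace ?W = V"
      using openin_subset[of ?W V] by auto
    ultimately show "openin ?W (id -` V \<inter> topspace ?W)" by (simp only:)
  qed (simp only: unionS topspace_subtopology image_id id_apply Int_lower2)
  \<comment> \<open>The identity is continuous in both directions, which forces the topologies to be
    equal.\<close>
  have "homeomorphic_maps ?W ?T id id"
    using TW WT by (simp add: homeomorphic_maps_def Lip_topology_def)
  then show ?thesis by (simp add: homeomorphic_maps_id)
qed

end
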